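(* Let $C$ be a Reedy category, let $\Gamma$ be one of $\int N(C)$, $\int N^{-,+}(C)$, $\int N^{--,+}_+(C)$, and let $(\alpha,\theta),(\alpha',\theta')\colon([m],X)\to([n],Y)$ be parallel morphisms in $\Gamma$. The following are equivalent: (1) $(\alpha,\theta)$ and $(\alpha',\theta')$ are equivalent; (2) $(\alpha,\theta)$ and $(\alpha',\theta')$ have a common upper bound in $\mathrm{Hom}_\Gamma(([m],X),([n],Y))$; (3) the largest element of $\{\psi:(\alpha,\theta)\le\psi\}$ coincides with the largest element of $\{\psi:(\alpha',\theta')\le\psi\}$ (these largest elements exist).
   Context: A Reedy category $(C,C_-,C_+)$: wide subcategories with unique factorization of every morphism as ($C_-$ then $C_+$), membership in $C_\pm$ decidable, and the relation ($x<'y$ iff non-identity $x\to y$ in $C_+$ or non-identity $y\to x$ in $C_-$) well-founded. $\Delta$: finite ordinals $[n]$ and order-preserving maps. $\int N(C)$: objects $([n],X)$ with $X\colon[n]\to C$ a functor; morphisms $([m],X)\to([n],Y)$ are $(\alpha,\theta)$, $\alpha\colon[m]\to[n]$ in $\Delta$, $\theta\colon X\Rightarrow Y\circ\alpha$; composition $(\beta,\varphi)\circ(\alpha,\theta)=(\beta\alpha,(\varphi\alpha)\circ\theta)$. $\int N^{-,+}(C)$: subcategory of objects with $X$ sending all morphisms into $C_-$ and morphisms with all $\theta_i\in C_+$. $\int N^{--,+}_+(C)$: its subcategory of objects whose $X$ reflects identities and morphisms with $\alpha$ injective. Order on hom-sets: $(\alpha,\theta)\le(\alpha',\theta')$ iff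 $\alpha\le\alpha'$ pointwise and $\theta'_i=Y(\alpha(i)\le\alpha'(i))\circ\theta_i$ for all $i$. Two parallel morphisms are equivalent if related by the equivalence relation (symmetric transitive closure) generated by $\le$ on the hom-set. *)

theory Defs
  imports Main
begin

record ('o, 'm) cat =
  Obj  :: "'o set"
  Arr  :: "'m set"
  Dom  :: "'m \<Rightarrow> 'o"
  Cod  :: "'m \<Rightarrow> 'o"
  Id   :: "'o \<Rightarrow> 'm"
  Comp :: "'m \<Rightarrow> 'm \<Rightarrow> 'm"   (* Comp C g f = g \<circ> f *)

definition category :: "('o, 'm) cat \<Rightarrow> bool" where
  "category C \<longleftrightarrow>
     (\<forall>f\<in>Arr C. Dom C f \<in> Obj C \<and> Cod C f \<in> Obj C) \<and>
     (\<forall>x\<in>Obj C. Id C x \<in> Arr C \<and> Dom C (Id C x) = x \<and> Cod C (Id C x) = x) \<and>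
     (\<forall>f\<in>Arr C. \<forall>g\<in>Arr C. Cod C f = Dom C g \<longrightarrow>
        Comp C g f \<in> Arr C \<and> Dom C (Comp C g f) = Dom C f \<and> Cod C (Comp C g f) = Cod C g) \<and>
     (\<forall>f\<in>Arr C. Comp C (Id C (Cod C f)) f = f \<and> Comp C f (Id C (Dom C f)) = f) \<and>
     (\<forall>f\<in>Arr C. \<forall>g\<in>Arr C. \<forall>h\<in>Arr C. Cod C f = Dom C g \<and> Cod C g = Dom C h \<longrightarrow>
        Comp C h (Comp C g f) = Comp C (Comp C h g) f)"

definition wide_subcat :: "('o, 'm) cat \<Rightarrow> 'm set \<Rightarrow> bool" where
  "wide_subcat C S \<longleftrightarrow> S \<subseteq> Arr C \<and> (\<forall>x\<in>Obj C. Id C x \<in> S) \<and>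
     (\<forall>f\<in>S. \<forall>g\<in>S. Cod C f = Dom C g \<longrightarrow> Comp C g f \<in> S)"

definition reedy_rel :: "('o, 'm) cat \<Rightarrow> 'm set \<Rightarrow> 'm set \<Rightarrow> ('o \<times> 'o) set" where
  "reedy_rel C Cm Cp = {(x, y). x \<in> Obj C \<and> y \<in> Obj C \<and>
     ((\<exists>f\<in>Cp. Dom C f = x \<and> Cod C f = y \<and> f \<noteq> Id C x) \<or>
      (\<exists>f\<in>Cm. Dom C f = y \<and> Cod C f = x \<and> f \<noteq> Id C y))}"

text \<open>Reedy category (C, C_-, C_+). Decidability of membership is automatic in HOL.\<close>
definition reedy :: "('o, 'm) cat \<Rightarrow> 'm set \<Rightarrow> 'm set \<Rightarrow> bool" where
  "reedy C Cm Cp \<longleftrightarrow> category C \<and> wide_subcat C Cm \<and> wide_subcat C Cp \<and>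
     (\<forall>f\<in>Arr C. \<exists>!pq. fst pq \<in> Cm \<and> snd pq \<in> Cp \<and> Cod C (fst pq) = Dom C (snd pq) \<and>
                      Comp C (snd pq) (fst pq) = f) \<and>
     wf (reedy_rel C Cm Cp)"

text \<open>A functor X : [n] \<rightarrow> C is encoded by X i j = X(i \<le> j) for i \<le> j \<le> n
  (and undefined elsewhere); the object X(i) is Dom C (X i i).\<close>
definition nobj :: "('o, 'm) cat \<Rightarrow> (nat \<Rightarrow> nat \<Rightarrow> 'm) \<Rightarrow> nat \<Rightarrow> 'o" where
  "nobj C X i = Dom C (X i i)"

definition nerve_obj :: "('o, 'm) cat \<Rightarrow> nat \<Rightarrow> (nat \<Rightarrow> nat \<Rightarrow> 'm) \<Rightarrow> bool" where
  "nerve_obj C n X \<longleftrightarrow>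
     (\<forall>i j. i \<le> j \<and> j \<le> n \<longrightarrow> X i j \<in> Arr C \<and> Dom C (X i j) = nobj C X i \<and>
                                   Cod C (X i j) = nobj C X j) \<and>
     (\<forall>i\<le>n. nobj C X i \<in> Obj C \<and> X i i = Id C (nobj C X i)) \<and>
     (\<forall>i j k. i \<le> j \<and> j \<le> k \<and> k \<le> n \<longrightarrow> X i k = Comp C (X j k) (X i j)) \<and>
     (\<forall>i j. \<not> (i \<le> j \<and> j \<le> n) \<longrightarrow> X i j = undefined)"

text \<open>Which of the three categories Gamma is meant:
  IntN = \<integral>N(C), IntNmp = \<integral>N^{-,+}(C), IntNmmp = \<integral>N^{--,+}_+(C).\<close>
datatype gamma = IntN | IntNmp | IntNmmp

definition gamma_obj :: "gamma \<Rightarrow> ('o, 'm) cat \<Rightarrow> 'm set \<Rightarrow> 'm set \<Rightarrow>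
    nat \<times> (nat \<Rightarrow> nat \<Rightarrow> 'm) \<Rightarrow> bool" where
  "gamma_obj G C Cm Cp nX \<longleftrightarrow> (case nX of (n, X) \<Rightarrow>
     nerve_obj C n X \<and>
     (G \<noteq> IntN \<longrightarrow> (\<forall>i j. i \<le> j \<and> j \<le> n \<longrightarrow> X i j \<in> Cm)) \<and>
     (G = IntNmmp \<longrightarrow> (\<forall>i j. i \<le> j \<and> j \<le> n \<and> X i j = Id C (nobj C X i) \<longrightarrow> i = j)))"

text \<open>Morphisms (alpha, theta) : ([m],X) \<rightarrow> ([n],Y); alpha and theta are
  extended by undefined outside {0..m}.\<close>
definition gamma_hom :: "gamma \<Rightarrow> ('o, 'm) cat \<Rightarrow> 'm set \<Rightarrow> 'm set \<Rightarrow>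
    nat \<times> (nat \<Rightarrow> nat \<Rightarrow> 'm) \<Rightarrow> nat \<times> (nat \<Rightarrow> nat \<Rightarrow> 'm) \<Rightarrow>
    ((nat \<Rightarrow> nat) \<times> (nat \<Rightarrow> 'm)) set" where
  "gamma_hom G C Cm Cp mX nY = (case mX of (m, X) \<Rightarrow> case nY of (n, Y) \<Rightarrow>
     {(\<alpha>, \<theta>). gamma_obj G C Cm Cp (m, X) \<and> gamma_obj G C Cm Cp (n, Y) \<and>
        (\<forall>i\<le>m. \<alpha> i \<le> n) \<and>
        (\<forall>i j. i \<le> j \<and> j \<le> m \<longrightarrow> \<alpha> i \<le> \<alpha> j) \<and>
        (\<forall>i>m. \<alpha> i = undefined \<and> \<theta> i = undefined) \<and>
        (\<forall>i\<le>m. \<theta> i \<in> Arr C \<and> Dom C (\<theta> i) = nobj C X i \<and> Cod C (\<theta> i) = nobj C Y (\<alpha> i)) \<and>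
        (\<forall>i j. i \<le> j \<and> j \<le> m \<longrightarrow>
            Comp C (\<theta> j) (X i j) = Comp C (Y (\<alpha> i) (\<alpha> j)) (\<theta> i)) \<and>
        (G \<noteq> IntN \<longrightarrow> (\<forall>i\<le>m. \<theta> i \<in> Cp)) \<and>
        (G = IntNmmp \<longrightarrow> inj_on \<alpha> {0..m})})"

definition hom_le :: "('o, 'm) cat \<Rightarrow> nat \<Rightarrow> (nat \<Rightarrow> nat \<Rightarrow> 'm) \<Rightarrow>
    (nat \<Rightarrow> nat) \<times> (nat \<Rightarrow> 'm) \<Rightarrow> (nat \<Rightarrow> nat) \<times> (nat \<Rightarrow> 'm) \<Rightarrow> bool" where
  "hom_le C m Y f g \<longleftrightarrow> (case f of (\<alpha>, \<theta>) \<Rightarrow> case g of (\<alpha>', \<theta>') \<Rightarrow>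
     (\<forall>i\<le>m. \<alpha> i \<le> \<alpha>' i \<and> \<theta>' i = Comp C (Y (\<alpha> i) (\<alpha>' i)) (\<theta> i)))"

definition hom_equiv where
  "hom_equiv C m Y H = equivclp (\<lambda>g h. g \<in> H \<and> h \<in> H \<and> hom_le C m Y g h)"

definition common_ub where
  "common_ub C m Y H f f' \<longleftrightarrow> (\<exists>g\<in>H. hom_le C m Y f g \<and> hom_le C m Y f' g)"

definition is_largest_above where
  "is_largest_above C m Y H f g \<longleftrightarrow> g \<in> H \<and> hom_le C m Y f g \<and>
     (\<forall>\<psi>\<in>H. hom_le C m Y f \<psi> \<longrightarrow> hom_le C m Y \<psi> g)"

definition largest_above where
  "largest_above C m Y H f = (THE g. is_largest_above C m Y H f g)"

end

theory Submission
  imports Defs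
begin

text \<open>The largest element above \<open>(\<alpha>, \<theta>)\<close> is obtained by pushing each component
  \<open>\<theta>\<^sub>i\<close> along \<open>Y\<close> as far as possible, staying inside \<open>C\<^sub>+\<close> where \<open>\<Gamma>\<close> requires it. That the
  resulting index map is monotone (and injective for \<open>\<integral>N\<^sup>-\<^sup>-\<^sup>,\<^sup>+\<^sub>+(C)\<close>) comes from a
  cancellation property of Reedy categories: if \<open>h \<circ> w \<in> C\<^sub>+\<close> with \<open>w \<in> C\<^sub>-\<close>, then \<open>w\<close> is an
  identity and \<open>h \<in> C\<^sub>+\<close>, by uniqueness of factorizations and because well-foundedness of
  \<open><'\<close> excludes cycles of length two. Once every element of a partially ordered hom-set has a
  largest element above it, two elements are equivalent iff they have the same largest element
  above them, iff they have a common upper bound.\<close>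

definition Hom :: "('o, 'm) cat \<Rightarrow> 'o \<Rightarrow> 'o \<Rightarrow> 'm set" where
  "Hom C a b = {f \<in> Arr C. Dom C f = a \<and> Cod C f = b}"

lemma HomD:
  assumes "f \<in> Hom C a b"
  shows "f \<in> Arr C" and "Dom C f = a" and "Cod C f = b"
  using assms by (simp_all add: Hom_def)

locale is_category =
  fixes C :: "('o, 'm) cat"
  assumes category: "category C"
begin

lemma Hom_dom_obj: "f \<in> Hom C a b \<Longrightarrow> a \<in> Obj C"
  and Hom_cod_obj: "f \<in> Hom C a b \<Longrightarrow> b \<in> Obj C"
  using category[unfolded category_def, THEN conjunct1] unfolding Hom_def by blast+

lemma Id_in_Hom: "a \<in> Obj C \<Longrightarrow> Id C a \<in> Hom C a a"
  using category[unfolded category_def, THEN conjunct2, THEN conjunct1] unfolding Hom_def by blast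

lemma comp_in_Hom: "f \<in> Hom C a b \<Longrightarrow> g \<in> Hom C b c \<Longrightarrow> Comp C g f \<in> Hom C a c"
  using category[unfolded category_def, THEN conjunct2, THEN conjunct2, THEN conjunct1]
  unfolding Hom_def by auto

lemma comp_Id_left: "f \<in> Hom C a b \<Longrightarrow> Comp C (Id C b) f = f"
  and comp_Id_right: "f \<in> Hom C a b \<Longrightarrow> Comp C f (Id C a) = f"
  using category[unfolded category_def, THEN conjunct2, THEN conjunct2, THEN conjunct2, THEN conjunct1]
  unfolding Hom_def by blast+

lemma comp_assoc:
  "f \<in> Hom C a b \<Longrightarrow> g \<in> Hom C b c \<Longrightarrow> h \<in> Hom C c d \<Longrightarrow>
    Comp C h (Comp C g f) = Comp C (Comp C h g) f"
  using category[unfolded category_def, THEN conjunct2, THEN conjunct2, THEN conjunct2, THEN conjunct2]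
  unfolding Hom_def by auto

end

lemma nerve_in_Hom:
  "nerve_obj C n Y \<Longrightarrow> i \<le> j \<Longrightarrow> j \<le> n \<Longrightarrow> Y i j \<in> Hom C (nobj C Y i) (nobj C Y j)"
  unfolding nerve_obj_def Hom_def by auto

lemma nerve_diag: "nerve_obj C n Y \<Longrightarrow> i \<le> n \<Longrightarrow> Y i i = Id C (nobj C Y i)"
  unfolding nerve_obj_def by auto

lemma nerve_comp:
  "nerve_obj C n Y \<Longrightarrow> i \<le> j \<Longrightarrow> j \<le> k \<Longrightarrow> k \<le> n \<Longrightarrow> Y i k = Comp C (Y j k) (Y i j)"
  unfolding nerve_obj_def by auto

context is_category
begin

lemma nerve_comp_assoc:
  assumes Y: "nerve_obj C n Y" and "i \<le> j" "j \<le> k" "k \<le> n"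
    and t: "t \<in> Hom C a (nobj C Y i)"
  shows "Comp C (Y j k) (Comp C (Y i j) t) = Comp C (Y i k) t"
  using comp_assoc[OF t nerve_in_Hom[OF Y] nerve_in_Hom[OF Y]] nerve_comp[OF Y, of i j k] assms(2-4)
  by simp

lemma nerve_diag_comp:
  "nerve_obj C n Y \<Longrightarrow> i \<le> n \<Longrightarrow> t \<in> Hom C a (nobj C Y i) \<Longrightarrow> Comp C (Y i i) t = t"
  by (simp add: nerve_diag comp_Id_left)

end

lemma gamma_homD:
  assumes "(\<alpha>, \<theta>) \<in> gamma_hom G C Cm Cp (m, X) (n, Y)"
  shows gamma_hom_source: "gamma_obj G C Cm Cp (m, X)"
    and gamma_hom_target: "gamma_obj G C Cm Cp (n, Y)"
    and gamma_hom_source_nerve: "nerve_obj C m X"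
    and gamma_hom_target_nerve: "nerve_obj C n Y"
    and gamma_hom_le_n: "\<And>i. i \<le> m \<Longrightarrow> \<alpha> i \<le> n"
    and gamma_hom_mono: "\<And>i j. i \<le> j \<Longrightarrow> j \<le> m \<Longrightarrow> \<alpha> i \<le> \<alpha> j"
    and gamma_hom_undefined: "\<And>i. m < i \<Longrightarrow> \<alpha> i = undefined \<and> \<theta> i = undefined"
    and gamma_hom_in_Hom: "\<And>i. i \<le> m \<Longrightarrow> \<theta> i \<in> Hom C (nobj C X i) (nobj C Y (\<alpha> i))"
    and gamma_hom_natural:
      "\<And>i j. i \<le> j \<Longrightarrow> j \<le> m \<Longrightarrow> Comp C (\<theta> j) (X i j) = Comp C (Y (\<alpha> i) (\<alpha> j)) (\<theta> i)"
    and gamma_hom_Cp: "\<And>i. G \<noteq> IntN \<Longrightarrow> i \<le> m \<Longrightarrow> \<theta> i \<in> Cp"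
    and gamma_hom_source_Cm: "\<And>i j. G \<noteq> IntN \<Longrightarrow> i \<le> j \<Longrightarrow> j \<le> m \<Longrightarrow> X i j \<in> Cm"
    and gamma_hom_source_reflects_Id:
      "\<And>i j. G = IntNmmp \<Longrightarrow> i \<le> j \<Longrightarrow> j \<le> m \<Longrightarrow> X i j = Id C (nobj C X i) \<Longrightarrow> i = j"
  using assms unfolding gamma_hom_def gamma_obj_def Hom_def by auto

lemma gamma_homI:
  assumes "gamma_obj G C Cm Cp (m, X)" and "gamma_obj G C Cm Cp (n, Y)"
    and "\<And>i. i \<le> m \<Longrightarrow> \<alpha> i \<le> n"
    and "\<And>i j. i \<le> j \<Longrightarrow> j \<le> m \<Longrightarrow> \<alpha> i \<le> \<alpha> j"
    and "\<And>i. m < i \<Longrightarrow> \<alpha> i = undefined \<and> \<theta> i = undefined"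
    and "\<And>i. i \<le> m \<Longrightarrow> \<theta> i \<in> Hom C (nobj C X i) (nobj C Y (\<alpha> i))"
    and "\<And>i j. i \<le> j \<Longrightarrow> j \<le> m \<Longrightarrow> Comp C (\<theta> j) (X i j) = Comp C (Y (\<alpha> i) (\<alpha> j)) (\<theta> i)"
    and "\<And>i. G \<noteq> IntN \<Longrightarrow> i \<le> m \<Longrightarrow> \<theta> i \<in> Cp"
    and "G = IntNmmp \<Longrightarrow> inj_on \<alpha> {0..m}"
  shows "(\<alpha>, \<theta>) \<in> gamma_hom G C Cm Cp (m, X) (n, Y)"
  using assms unfolding gamma_hom_def Hom_def by auto

locale reedy_category =
  fixes C :: "('o, 'm) cat" and Cm Cp :: "'m set"
  assumes reedy: "reedy C Cm Cp"
begin

lemma category: "category C"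
  and Cm_wide: "wide_subcat C Cm"
  and Cp_wide: "wide_subcat C Cp"
  and unique_factorization: "\<forall>f\<in>Arr C. \<exists>!pq. fst pq \<in> Cm \<and> snd pq \<in> Cp \<and>
        Cod C (fst pq) = Dom C (snd pq) \<and> Comp C (snd pq) (fst pq) = f"
  and wf_reedy_rel: "wf (reedy_rel C Cm Cp)"
  using reedy unfolding reedy_def by blast+

end

sublocale reedy_category \<subseteq> is_category
  by unfold_locales (rule category)

context reedy_category
begin

lemma Cm_comp_closed:
  "q \<in> Cm \<Longrightarrow> q \<in> Hom C a b \<Longrightarrow> q' \<in> Cm \<Longrightarrow> q' \<in> Hom C b c \<Longrightarrow> Comp C q' q \<in> Cm"
  using Cm_wide unfolding wide_subcat_def Hom_def by auto

lemma Id_in_Cm: "a \<in> Obj C \<Longrightarrow> Id C a \<in> Cm"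
  using Cm_wide unfolding wide_subcat_def by auto

lemma factorization_exists:
  assumes f: "f \<in> Hom C a c"
  obtains b q p where "q \<in> Cm" "q \<in> Hom C a b" "p \<in> Cp" "p \<in> Hom C b c" "Comp C p q = f"
proof -
  obtain q p where qp: "q \<in> Cm" "p \<in> Cp" "Cod C q = Dom C p" "Comp C p q = f"
    using unique_factorization HomD(1)[OF f] by metis
  have "q \<in> Hom C (Dom C q) (Dom C p)" "p \<in> Hom C (Dom C p) (Cod C p)"
    using qp Cm_wide Cp_wide unfolding wide_subcat_def Hom_def by auto
  moreover from HomD(2,3)[OF comp_in_Hom[OF this]] have "Dom C q = a" "Cod C p = c"
    using HomD(2,3)[OF f] qp(4) by simp_all
  ultimately show thesis using that qp by metis
qed

lemma factorization_unique:
  assumes "q \<in> Cm" "q \<in> Hom C a b" "p \<in> Cp" "p \<in> Hom C b c"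
    and "q' \<in> Cm" "q' \<in> Hom C a b'" "p' \<in> Cp" "p' \<in> Hom C b' c"
    and "Comp C p q = Comp C p' q'"
  shows "q = q'" and "p = p'"
proof -
  have "Comp C p q \<in> Arr C" using HomD(1)[OF comp_in_Hom[OF assms(2,4)]] .
  then have "\<exists>!pq. fst pq \<in> Cm \<and> snd pq \<in> Cp \<and> Cod C (fst pq) = Dom C (snd pq) \<and>
                  Comp C (snd pq) (fst pq) = Comp C p q"
    using unique_factorization by blast
  then have "(q, p) = (q', p')"
    using assms unfolding Hom_def by (metis (mono_tags, lifting) fst_conv mem_Collect_eq snd_conv)
  then show "q = q'" and "p = p'" by simp_all
qed

lemma Cm_section_eq_Id:
  assumes q: "q \<in> Cm" "q \<in> Hom C a b" and r: "r \<in> Cm" "r \<in> Hom C b a"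
    and rq: "Comp C r q = Id C a"
  shows "q = Id C a"
proof (rule ccontr)
  assume q_ne: "q \<noteq> Id C a"
  have "r \<noteq> Id C b"
  proof
    assume "r = Id C b"
    then have "Comp C r q = q" using comp_Id_left[OF q(2)] by simp
    with rq q_ne show False by simp
  qed
  then have "(a, b) \<in> reedy_rel C Cm Cp"
    using r(1) HomD(2,3)[OF r(2)] Hom_dom_obj[OF q(2)] Hom_cod_obj[OF q(2)]
    unfolding reedy_rel_def by blast
  moreover have "(b, a) \<in> reedy_rel C Cm Cp"
    using q(1) q_ne HomD(2,3)[OF q(2)] Hom_dom_obj[OF q(2)] Hom_cod_obj[OF q(2)]
    unfolding reedy_rel_def by auto
  ultimately show False using wf_not_sym[OF wf_reedy_rel] by blast
qed

text \<open>Comparing the factorization \<open>h = p \<circ> q\<close> with the trivial factorization of \<open>h \<circ> w\<close>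
  shows that \<open>q \<circ> w\<close> is an identity, so \<open>w\<close> is a section in \<open>C\<^sub>-\<close>.\<close>
lemma Cp_comp_Cm_cancel:
  assumes w: "w \<in> Cm" "w \<in> Hom C a b" and h: "h \<in> Hom C b c" and hw: "Comp C h w \<in> Cp"
  shows "w = Id C a" and "h \<in> Cp"
proof -
  obtain d q p where q: "q \<in> Cm" "q \<in> Hom C b d" and p: "p \<in> Cp" "p \<in> Hom C d c"
    and h_eq: "Comp C p q = h"
    using factorization_exists[OF h] by metis
  have a: "a \<in> Obj C" using Hom_dom_obj[OF w(2)] .
  have hw_Hom: "Comp C h w \<in> Hom C a c" using comp_in_Hom[OF w(2) h] .
  have "Comp C p (Comp C q w) = Comp C (Comp C h w) (Id C a)"
    using comp_assoc[OF w(2) q(2) p(2)] h_eq comp_Id_right[OF hw_Hom] by simp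
  then have qw: "Comp C q w = Id C a" and p_eq: "p = Comp C h w"
    using factorization_unique[OF Cm_comp_closed[OF w q] comp_in_Hom[OF w(2) q(2)] p
        Id_in_Cm[OF a] Id_in_Hom[OF a] hw hw_Hom]
    by simp_all
  have "d = a"
    using HomD(3)[OF comp_in_Hom[OF w(2) q(2)]] HomD(3)[OF Id_in_Hom[OF a]] qw by simp
  with q have q': "q \<in> Hom C b a" by simp
  show w_Id: "w = Id C a" using Cm_section_eq_Id[OF w q(1) q' qw] .
  then have "b = a" using HomD(3)[OF w(2)] HomD(3)[OF Id_in_Hom[OF a]] by simp
  then have "q = Id C a" using comp_Id_right[OF q'] qw w_Id by simp
  then have "h = p" using h_eq comp_Id_right[OF p(2)] \<open>d = a\<close> by simp
  with p show "h \<in> Cp" by simp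
qed

end

locale reedy_gamma_hom = reedy_category +
  fixes G :: gamma and m n :: nat and X Y :: "nat \<Rightarrow> nat \<Rightarrow> 'm"
    and \<alpha> :: "nat \<Rightarrow> nat" and \<theta> :: "nat \<Rightarrow> 'm"
  assumes hom: "(\<alpha>, \<theta>) \<in> gamma_hom G C Cm Cp (m, X) (n, Y)"
begin

lemmas X_nerve = gamma_hom_source_nerve[OF hom]
  and Y_nerve = gamma_hom_target_nerve[OF hom]
  and \<theta>_in_Hom = gamma_hom_in_Hom[OF hom]

definition admissible :: "nat \<Rightarrow> nat \<Rightarrow> bool" where
  "admissible i k \<longleftrightarrow> \<alpha> i \<le> k \<and> k \<le> n \<and> (G \<noteq> IntN \<longrightarrow> Comp C (Y (\<alpha> i) k) (\<theta> i) \<in> Cp)"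

definition top_alpha :: "nat \<Rightarrow> nat" where
  "top_alpha i = (if i \<le> m then Max {k. admissible i k} else undefined)"

definition top_theta :: "nat \<Rightarrow> 'm" where
  "top_theta i = (if i \<le> m then Comp C (Y (\<alpha> i) (top_alpha i)) (\<theta> i) else undefined)"

lemma push_in_Hom:
  "i \<le> m \<Longrightarrow> \<alpha> i \<le> k \<Longrightarrow> k \<le> n \<Longrightarrow>
    Comp C (Y (\<alpha> i) k) (\<theta> i) \<in> Hom C (nobj C X i) (nobj C Y k)"
  using comp_in_Hom[OF \<theta>_in_Hom nerve_in_Hom[OF Y_nerve]] by blast

lemma push_natural:
  assumes ij: "i \<le> j" "j \<le> m" and k: "\<alpha> j \<le> k" "k \<le> n"
  shows "Comp C (Comp C (Y (\<alpha> j) k) (\<theta> j)) (X i j) = Comp C (Y (\<alpha> i) k) (\<theta> i)"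
proof -
  have "Comp C (Comp C (Y (\<alpha> j) k) (\<theta> j)) (X i j) = Comp C (Y (\<alpha> j) k) (Comp C (\<theta> j) (X i j))"
    using comp_assoc[OF nerve_in_Hom[OF X_nerve ij] \<theta>_in_Hom[OF ij(2)] nerve_in_Hom[OF Y_nerve k]]
    by simp
  also have "\<dots> = Comp C (Y (\<alpha> j) k) (Comp C (Y (\<alpha> i) (\<alpha> j)) (\<theta> i))"
    using gamma_hom_natural[OF hom ij] by simp
  also have "\<dots> = Comp C (Y (\<alpha> i) k) (\<theta> i)"
    using nerve_comp_assoc[OF Y_nerve gamma_hom_mono[OF hom ij] k \<theta>_in_Hom] ij by simp
  finally show ?thesis .
qed

lemma admissible_alpha: "i \<le> m \<Longrightarrow> admissible i (\<alpha> i)"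
  using nerve_diag_comp[OF Y_nerve gamma_hom_le_n[OF hom] \<theta>_in_Hom] gamma_hom_le_n[OF hom]
    gamma_hom_Cp[OF hom]
  unfolding admissible_def by simp

lemma finite_admissible: "finite {k. admissible i k}"
  by (rule finite_subset[of _ "{..n}"]) (auto simp: admissible_def)

lemma admissible_top_alpha:
  assumes i: "i \<le> m"
  shows "admissible i (top_alpha i)"
proof -
  have "{k. admissible i k} \<noteq> {}" using admissible_alpha[OF i] by blast
  from Max_in[OF finite_admissible this] i show ?thesis unfolding top_alpha_def by simp
qed

lemma admissible_le_top_alpha: "i \<le> m \<Longrightarrow> admissible i k \<Longrightarrow> k \<le> top_alpha i"
  using Max_ge[OF finite_admissible] unfolding top_alpha_def by simp

lemma alpha_le_top_alpha: "i \<le> m \<Longrightarrow> \<alpha> i \<le> top_alpha i"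
  and top_alpha_le_n: "i \<le> m \<Longrightarrow> top_alpha i \<le> n"
  using admissible_top_alpha unfolding admissible_def by blast+

lemma top_theta_in_Hom: "i \<le> m \<Longrightarrow> top_theta i \<in> Hom C (nobj C X i) (nobj C Y (top_alpha i))"
  using push_in_Hom alpha_le_top_alpha top_alpha_le_n unfolding top_theta_def by simp

lemma top_theta_Cp: "G \<noteq> IntN \<Longrightarrow> i \<le> m \<Longrightarrow> top_theta i \<in> Cp"
  using admissible_top_alpha unfolding admissible_def top_theta_def by simp

text \<open>Monotonicity is where the Reedy structure enters: precomposing the pushed component
  at \<open>j\<close> with \<open>X(i \<le> j) \<in> C\<^sub>-\<close> gives the one at \<open>i\<close>, which lies in \<open>C\<^sub>+\<close>, so the
  pushed component at \<open>j\<close> lies in \<open>C\<^sub>+\<close> as well.\<close>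
lemma top_alpha_mono:
  assumes ij: "i \<le> j" "j \<le> m"
  shows "top_alpha i \<le> top_alpha j"
proof (cases "\<alpha> j \<le> top_alpha i")
  case False
  then show ?thesis using alpha_le_top_alpha[OF ij(2)] by simp
next
  case True
  have i: "i \<le> m" using ij by simp
  have "Comp C (Y (\<alpha> j) (top_alpha i)) (\<theta> j) \<in> Cp" if G: "G \<noteq> IntN"
  proof (rule Cp_comp_Cm_cancel(2))
    show "X i j \<in> Cm" using gamma_hom_source_Cm[OF hom G ij] .
    show "X i j \<in> Hom C (nobj C X i) (nobj C X j)" using nerve_in_Hom[OF X_nerve ij] .
    show "Comp C (Y (\<alpha> j) (top_alpha i)) (\<theta> j) \<in> Hom C (nobj C X j) (nobj C Y (top_alpha i))"
      using push_in_Hom[OF ij(2) True top_alpha_le_n[OF i]] .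
    show "Comp C (Comp C (Y (\<alpha> j) (top_alpha i)) (\<theta> j)) (X i j) \<in> Cp"
      using push_natural[OF ij True top_alpha_le_n[OF i]] admissible_top_alpha[OF i] G
      unfolding admissible_def by simp
  qed
  then have "admissible j (top_alpha i)"
    using True top_alpha_le_n[OF i] unfolding admissible_def by simp
  then show ?thesis using admissible_le_top_alpha[OF ij(2)] by simp
qed

lemma top_theta_natural:
  assumes ij: "i \<le> j" "j \<le> m"
  shows "Comp C (top_theta j) (X i j) = Comp C (Y (top_alpha i) (top_alpha j)) (top_theta i)"
proof -
  have i: "i \<le> m" using ij by simp
  have "Comp C (top_theta j) (X i j) = Comp C (Y (\<alpha> i) (top_alpha j)) (\<theta> i)"
    using push_natural[OF ij alpha_le_top_alpha top_alpha_le_n] ij unfolding top_theta_def by simp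
  also have "\<dots> = Comp C (Y (top_alpha i) (top_alpha j)) (top_theta i)"
    using nerve_comp_assoc[OF Y_nerve alpha_le_top_alpha[OF i] top_alpha_mono[OF ij]
        top_alpha_le_n[OF ij(2)] \<theta>_in_Hom[OF i]] i
    unfolding top_theta_def by simp
  finally show ?thesis .
qed

text \<open>For \<open>\<integral>N\<^sup>-\<^sup>-\<^sup>,\<^sup>+\<^sub>+(C)\<close>: if \<open>top_alpha\<close> identified \<open>i < j\<close>, naturality would
  put \<open>top_theta j \<circ> X(i \<le> j)\<close> in \<open>C\<^sub>+\<close>, forcing \<open>X(i \<le> j)\<close> to be an identity.\<close>
lemma top_alpha_inj:
  assumes G: "G = IntNmmp"
  shows "inj_on top_alpha {0..m}"
proof (rule linorder_inj_onI')
  fix i j assume "i \<in> {0..m}" "j \<in> {0..m}" "i < j"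
  then have ij: "i \<le> j" "j \<le> m" and i: "i \<le> m" and "i \<noteq> j" by auto
  show "top_alpha i \<noteq> top_alpha j"
  proof
    assume eq: "top_alpha i = top_alpha j"
    have "Comp C (top_theta j) (X i j) = top_theta i"
      using top_theta_natural[OF ij] nerve_diag_comp[OF Y_nerve top_alpha_le_n[OF i] top_theta_in_Hom[OF i]]
      by (simp add: eq)
    then have "X i j = Id C (nobj C X i)"
      using Cp_comp_Cm_cancel(1)[OF gamma_hom_source_Cm[OF hom _ ij] nerve_in_Hom[OF X_nerve ij]
          top_theta_in_Hom[OF ij(2)]] top_theta_Cp[OF _ i] G eq
      by simp
    with gamma_hom_source_reflects_Id[OF hom G ij] \<open>i \<noteq> j\<close> show False by simp
  qed
qed

lemma top_in_gamma_hom: "(top_alpha, top_theta) \<in> gamma_hom G C Cm Cp (m, X) (n, Y)"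
proof (rule gamma_homI[OF gamma_hom_source[OF hom] gamma_hom_target[OF hom]])
  show "top_alpha i = undefined \<and> top_theta i = undefined" if "m < i" for i
    using that unfolding top_alpha_def top_theta_def by simp
  show "G = IntNmmp \<Longrightarrow> inj_on top_alpha {0..m}" by (rule top_alpha_inj)
qed (simp_all add: top_alpha_le_n top_alpha_mono top_theta_in_Hom top_theta_natural top_theta_Cp)

lemma le_top: "hom_le C m Y (\<alpha>, \<theta>) (top_alpha, top_theta)"
  using alpha_le_top_alpha unfolding hom_le_def top_theta_def by simp

lemma above_le_top:
  assumes \<psi>: "(\<beta>, \<eta>) \<in> gamma_hom G C Cm Cp (m, X) (n, Y)"
    and le: "hom_le C m Y (\<alpha>, \<theta>) (\<beta>, \<eta>)"
  shows "hom_le C m Y (\<beta>, \<eta>) (top_alpha, top_theta)"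
  unfolding hom_le_def prod.case
proof (intro allI impI conjI)
  fix i assume i: "i \<le> m"
  have \<alpha>\<beta>: "\<alpha> i \<le> \<beta> i" and \<eta>: "\<eta> i = Comp C (Y (\<alpha> i) (\<beta> i)) (\<theta> i)"
    using le i unfolding hom_le_def by simp_all
  have "admissible i (\<beta> i)"
    using \<alpha>\<beta> \<eta> gamma_hom_le_n[OF \<psi> i] gamma_hom_Cp[OF \<psi> _ i] unfolding admissible_def by simp
  then show \<beta>_le: "\<beta> i \<le> top_alpha i" using admissible_le_top_alpha[OF i] by simp
  show "top_theta i = Comp C (Y (\<beta> i) (top_alpha i)) (\<eta> i)"
    using nerve_comp_assoc[OF Y_nerve \<alpha>\<beta> \<beta>_le top_alpha_le_n[OF i] \<theta>_in_Hom[OF i]] \<eta> i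
    unfolding top_theta_def by simp
qed

lemma is_largest_above_top:
  "is_largest_above C m Y (gamma_hom G C Cm Cp (m, X) (n, Y)) (\<alpha>, \<theta>) (top_alpha, top_theta)"
  unfolding is_largest_above_def using top_in_gamma_hom le_top above_le_top by auto

end

context is_category
begin

lemma hom_le_trans:
  assumes f: "f \<in> gamma_hom G C Cm Cp (m, X) (n, Y)" and h: "h \<in> gamma_hom G C Cm Cp (m, X) (n, Y)"
    and fg: "hom_le C m Y f g" and gh: "hom_le C m Y g h"
  shows "hom_le C m Y f h"
proof -
  obtain \<alpha>\<^sub>1 \<theta>\<^sub>1 \<alpha>\<^sub>2 \<theta>\<^sub>2 \<alpha>\<^sub>3 \<theta>\<^sub>3 where
    fgh: "f = (\<alpha>\<^sub>1, \<theta>\<^sub>1)" "g = (\<alpha>\<^sub>2, \<theta>\<^sub>2)" "h = (\<alpha>\<^sub>3, \<theta>\<^sub>3)"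
    by (metis surj_pair)
  note f = f[unfolded fgh] and h = h[unfolded fgh]
  have "\<alpha>\<^sub>1 i \<le> \<alpha>\<^sub>3 i \<and> \<theta>\<^sub>3 i = Comp C (Y (\<alpha>\<^sub>1 i) (\<alpha>\<^sub>3 i)) (\<theta>\<^sub>1 i)" if i: "i \<le> m" for i
  proof -
    have 12: "\<alpha>\<^sub>1 i \<le> \<alpha>\<^sub>2 i" "\<theta>\<^sub>2 i = Comp C (Y (\<alpha>\<^sub>1 i) (\<alpha>\<^sub>2 i)) (\<theta>\<^sub>1 i)"
      and 23: "\<alpha>\<^sub>2 i \<le> \<alpha>\<^sub>3 i" "\<theta>\<^sub>3 i = Comp C (Y (\<alpha>\<^sub>2 i) (\<alpha>\<^sub>3 i)) (\<theta>\<^sub>2 i)"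
      using fg gh i unfolding fgh hom_le_def by simp_all
    then show ?thesis
      using nerve_comp_assoc[OF gamma_hom_target_nerve[OF f] 12(1) 23(1) gamma_hom_le_n[OF h i]
          gamma_hom_in_Hom[OF f i]]
      by simp
  qed
  then show ?thesis unfolding fgh hom_le_def by simp
qed

lemma hom_le_antisym:
  assumes f: "f \<in> gamma_hom G C Cm Cp (m, X) (n, Y)" and g: "g \<in> gamma_hom G C Cm Cp (m, X) (n, Y)"
    and fg: "hom_le C m Y f g" and gf: "hom_le C m Y g f"
  shows "f = g"
proof -
  obtain \<alpha> \<theta> \<beta> \<eta> where fg_eq: "f = (\<alpha>, \<theta>)" "g = (\<beta>, \<eta>)" by (metis surj_pair)
  note f = f[unfolded fg_eq] and g = g[unfolded fg_eq]
  have "\<alpha> i = \<beta> i \<and> \<theta> i = \<eta> i" for i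
  proof (cases "i \<le> m")
    case True
    then have "\<alpha> i = \<beta> i" "\<eta> i = Comp C (Y (\<alpha> i) (\<alpha> i)) (\<theta> i)"
      using fg gf unfolding fg_eq hom_le_def by fastforce+
    then show ?thesis
      using nerve_diag_comp[OF gamma_hom_target_nerve[OF f] gamma_hom_le_n[OF f True]
          gamma_hom_in_Hom[OF f True]]
      by simp
  next
    case False
    then show ?thesis using gamma_hom_undefined[OF f] gamma_hom_undefined[OF g] by simp
  qed
  then show ?thesis unfolding fg_eq by auto
qed

end

lemma (in reedy_category) gamma_hom_largest_above_exists:
  assumes "f \<in> gamma_hom G C Cm Cp (m, X) (n, Y)"
  shows "\<exists>g. is_largest_above C m Y (gamma_hom G C Cm Cp (m, X) (n, Y)) f g"
proof -
  obtain \<alpha> \<theta> where f: "f = (\<alpha>, \<theta>)" by fastforce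
  interpret reedy_gamma_hom C Cm Cp G m n X Y \<alpha> \<theta>
    using assms unfolding f by unfold_locales
  show ?thesis using is_largest_above_top unfolding f by blast
qed

locale hom_order_with_largest_above =
  fixes C :: "('o, 'm) cat" and m :: nat and Y :: "nat \<Rightarrow> nat \<Rightarrow> 'm"
    and H :: "((nat \<Rightarrow> nat) \<times> (nat \<Rightarrow> 'm)) set"
  assumes le_trans: "\<lbrakk>f \<in> H; g \<in> H; h \<in> H; hom_le C m Y f g; hom_le C m Y g h\<rbrakk> \<Longrightarrow> hom_le C m Y f h"
    and le_antisym: "\<lbrakk>f \<in> H; g \<in> H; hom_le C m Y f g; hom_le C m Y g f\<rbrakk> \<Longrightarrow> f = g"
    and largest_above_exists: "f \<in> H \<Longrightarrow> \<exists>g. is_largest_above C m Y H f g"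
begin

lemma largest_above_eqI:
  assumes "is_largest_above C m Y H f g"
  shows "largest_above C m Y H f = g"
  unfolding largest_above_def
proof (rule the_equality)
  show "is_largest_above C m Y H f g" by fact
  show "g' = g" if "is_largest_above C m Y H f g'" for g'
    using that assms le_antisym unfolding is_largest_above_def by blast
qed

lemma is_largest_above_largest_above:
  "f \<in> H \<Longrightarrow> is_largest_above C m Y H f (largest_above C m Y H f)"
  using largest_above_exists largest_above_eqI by metis

lemma largest_above_eq_if_le:
  assumes f: "f \<in> H" and g: "g \<in> H" and fg: "hom_le C m Y f g"
  shows "largest_above C m Y H g = largest_above C m Y H f"
proof (rule largest_above_eqI)
  have top: "is_largest_above C m Y H f (largest_above C m Y H f)"
    using is_largest_above_largest_above[OF f] .
  then show "is_largest_above C m Y H g (largest_above C m Y H f)"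
    using f g fg le_trans unfolding is_largest_above_def by blast
qed

lemma hom_equiv_imp_largest_above_eq:
  assumes equiv: "hom_equiv C m Y H f f'" and f: "f \<in> H"
  shows "largest_above C m Y H f = largest_above C m Y H f'"
proof -
  from equiv have "f' \<in> H \<and> largest_above C m Y H f' = largest_above C m Y H f"
    unfolding hom_equiv_def
  proof (induction rule: equivclp_induct)
    case base
    then show ?case using f by simp
  next
    case (step g h)
    then show ?case using largest_above_eq_if_le by metis
  qed
  then show ?thesis by simp
qed

lemma largest_above_eq_imp_common_ub:
  assumes "f \<in> H" "f' \<in> H" and "largest_above C m Y H f = largest_above C m Y H f'"
  shows "common_ub C m Y H f f'"
  using assms is_largest_above_largest_above unfolding common_ub_def is_largest_above_def by metis

lemma common_ub_imp_hom_equiv: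
  assumes "f \<in> H" "f' \<in> H" and "common_ub C m Y H f f'"
  shows "hom_equiv C m Y H f f'"
proof -
  obtain g where g: "g \<in> H" "hom_le C m Y f g" "hom_le C m Y f' g"
    using assms(3) unfolding common_ub_def by blast
  let ?le = "\<lambda>g h. g \<in> H \<and> h \<in> H \<and> hom_le C m Y g h"
  have "equivclp ?le f g" and "equivclp ?le g f'"
    using assms(1,2) g by auto
  then show ?thesis unfolding hom_equiv_def by (rule equivclp_trans)
qed

end

theorem proposition4p6:
  fixes C :: "('o, 'm) cat" and Cm Cp :: "'m set" and G :: gamma
    and m n :: nat and X Y :: "nat \<Rightarrow> nat \<Rightarrow> 'm"
    and f f' :: "(nat \<Rightarrow> nat) \<times> (nat \<Rightarrow> 'm)"
  defines "H \<equiv> gamma_hom G C Cm Cp (m, X) (n, Y)"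
  assumes "reedy C Cm Cp"
    and "f \<in> H" and "f' \<in> H"
  shows "(\<exists>g. is_largest_above C m Y H f g) \<and> (\<exists>g. is_largest_above C m Y H f' g) \<and>
    (hom_equiv C m Y H f f' \<longleftrightarrow> common_ub C m Y H f f') \<and>
    (common_ub C m Y H f f' \<longleftrightarrow> largest_above C m Y H f = largest_above C m Y H f')"
proof -
  interpret reedy_category C Cm Cp by unfold_locales fact
  interpret hom_order_with_largest_above C m Y H
    unfolding H_def
    by unfold_locales (blast intro: hom_le_trans hom_le_antisym gamma_hom_largest_above_exists)+
  show ?thesis
    using assms(3,4) largest_above_exists hom_equiv_imp_largest_above_eq
      largest_above_eq_imp_common_ub common_ub_imp_hom_equiv
    by blast
qed

end
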